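(* Let $\mathcal{I}$ be an increasing-invariant ideal on $\omega$. If $A\in H(\mathcal{I})$ and $\{a_0,a_1,\ldots\}$ is the increasing enumeration of $A$, then the function $f\colon\omega\to A$ given by $f(n)=a_n$ witnesses that $\mathcal{I}|A\cong\mathcal{I}$.
   Context: $\omega=\{0,1,2,\ldots\}$ and $n\in\omega$ is identified with $\{0,\ldots,n-1\}$. An ideal on $\omega$ is a family $\mathcal{I}$ of subsets of $\omega$ with $\emptyset\in\mathcal{I}$, $\omega\notin\mathcal{I}$, closed under finite unions and subsets; all ideals considered are assumed to contain all finite subsets of $\omega$. An ideal $\mathcal{I}$ is increasing-invariant if for every $B\in\mathcal{I}$ and every $C\subseteq\omega$ satisfying $\mathrm{card}(C\cap n)\leq\mathrm{card}(B\cap n)$ for all $n$, we have $C\in\mathcal{I}$. For $A\subseteq\omega$ with $A\notin\mathcal{I}$, $\mathcal{I}|A=\{A\cap B:\ B\in\mathcal{I}\}$ is the restriction of $\mathcal{I}$ to $A$ (an ideal on $A$). $\mathcal{I}|A\cong\mathcal{I}$ means that there is a bijection $\phi\colon\omega\to A$ such that for all $B\subseteq A$, $B\in\mathcal{I}|A\iff\phi^{-1}[B]\in\mathcal{I}$; such a $\phi$ is said to witness that $\mathcal{I}|A\cong\mathcal{I}$. The homogeneity family of $\mathcal{I}$ is $H(\mathcal{I})=\{A\subseteq\omega:\ A\notin\mathcal{I}\text{ and }\mathcal{I}|A\cong\mathcal{I}\}$. *)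

theory Defs
  imports Main "HOL-Library.Infinite_Set"
begin

(* As usual for ideals on \<omega>, all finite sets are required to be members. *)
definition omega_ideal :: "nat set set \<Rightarrow> bool" where
  "omega_ideal I \<longleftrightarrow>
     {} \<in> I \<and> UNIV \<notin> I \<and>
     (\<forall>B\<in>I. \<forall>C\<in>I. B \<union> C \<in> I) \<and>
     (\<forall>B\<in>I. \<forall>C. C \<subseteq> B \<longrightarrow> C \<in> I) \<and>
     (\<forall>F. finite F \<longrightarrow> F \<in> I)"

definition increasing_invariant :: "nat set set \<Rightarrow> bool" where
  "increasing_invariant I \<longleftrightarrow>
     (\<forall>B\<in>I. \<forall>C. (\<forall>n. card (C \<inter> {..<n}) \<le> card (B \<inter> {..<n})) \<longrightarrow> C \<in> I)"

definition restrict_ideal :: "nat set set \<Rightarrow> nat set \<Rightarrow> nat set set" where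
  "restrict_ideal I A = {A \<inter> B | B. B \<in> I}"

definition witnesses_iso :: "(nat \<Rightarrow> nat) \<Rightarrow> nat set set \<Rightarrow> nat set \<Rightarrow> bool" where
  "witnesses_iso \<phi> I A \<longleftrightarrow>
     bij_betw \<phi> UNIV A \<and>
     (\<forall>B. B \<subseteq> A \<longrightarrow> (B \<in> restrict_ideal I A \<longleftrightarrow> \<phi> -` B \<in> I))"

definition homogeneity_family :: "nat set set \<Rightarrow> nat set set" where
  "homogeneity_family I = {A. A \<notin> I \<and> (\<exists>\<phi>. witnesses_iso \<phi> I A)}"

end

theory Submission
  imports Defs
begin

text \<open>
  If \<open>\<phi>\<close> witnesses the isomorphism and \<open>e\<close> is the increasing enumeration of \<open>A\<close>, then
  \<open>J = {X. e[X] \<in> I}\<close> is again increasing-invariant, and the permutation \<open>\<sigma> = \<phi>\<^sup>-\<^sup>1 \<circ> e\<close>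
  maps every member of \<open>J\<close> to a member of \<open>I\<close>. This forces \<open>J \<subseteq> I\<close>. Let \<open>C \<in> J\<close>;
  since \<open>\<sigma>[C] \<in> I\<close>, we may assume that \<open>\<sigma>\<close> moves every element of \<open>C\<close> up. Across each
  level \<open>n\<close>, the permutation \<open>\<sigma>\<close> moves equally many numbers up and down. Collecting just
  enough of the latter gives a set \<open>T\<close> no denser than \<open>C\<close>, so \<open>T \<in> J\<close>, such that the member
  \<open>\<sigma>[C] \<union> \<sigma>[T]\<close> of \<open>I\<close> is at least as dense as \<open>C\<close>.
\<close>

lemma increasing_invariantD:
  assumes "increasing_invariant I" "B \<in> I"
    and "\<And>n. card (C \<inter> {..<n}) \<le> card (B \<inter> {..<n})"
  shows "C \<in> I"
  using assms unfolding increasing_invariant_def by blast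

lemma increasing_invariant_subset:
  assumes "increasing_invariant I" "B \<in> I" "C \<subseteq> B"
  shows "C \<in> I"
  by (rule increasing_invariantD[OF assms(1,2)]) (use assms(3) in \<open>auto intro!: card_mono\<close>)

text \<open>Since \<open>g\<close> moves no point of \<open>X\<close> down, an image point below
  \<open>n\<close> comes from a point of \<open>X\<close> below \<open>n\<close>. Collisions under
  \<open>g\<close> only lower the count.\<close>

lemma increasing_invariant_image:
  assumes "increasing_invariant I" "X \<in> I" and le: "\<And>x. x \<in> X \<Longrightarrow> x \<le> g x"
  shows "g ` X \<in> I"
proof (rule increasing_invariantD[OF assms(1,2)])
  fix n
  have "g ` X \<inter> {..<n} \<subseteq> g ` (X \<inter> {..<n})"
    using le by fastforce
  then have "card (g ` X \<inter> {..<n}) \<le> card (g ` (X \<inter> {..<n}))"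
    by (intro card_mono) auto
  also have "\<dots> \<le> card (X \<inter> {..<n})"
    by (rule card_image_le) auto
  finally show "card (g ` X \<inter> {..<n}) \<le> card (X \<inter> {..<n})" .
qed

text \<open>Counting images below \<open>n\<close> amounts to counting arguments below the least
  \<open>m\<close> with \<open>n \<le> e m\<close>, and this \<open>m\<close> is the same for
  \<open>B\<close> and \<open>C\<close>.\<close>

lemma increasing_invariant_strict_mono_preimage:
  fixes e :: "nat \<Rightarrow> nat"
  assumes "increasing_invariant I" and "strict_mono e"
  shows "increasing_invariant {X. e ` X \<in> I}"
  unfolding increasing_invariant_def
proof (intro ballI allI impI)
  fix B C assume B: "B \<in> {X. e ` X \<in> I}"
    and le: "\<forall>n. card (C \<inter> {..<n}) \<le> card (B \<inter> {..<n})"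
  have inj: "inj_on e X" for X
    using assms(2) strict_mono_imp_inj_on inj_on_subset by blast
  have "card (e ` C \<inter> {..<n}) \<le> card (e ` B \<inter> {..<n})" for n
  proof -
    define m where "m = (LEAST m. n \<le> e m)"
    have ex: "n \<le> e n"
      using assms(2) by (simp add: strict_mono_imp_increasing)
    have "n \<le> e m"
      unfolding m_def using ex by (rule LeastI)
    then have iff: "e x < n \<longleftrightarrow> x < m" for x
      using not_less_Least[of x "\<lambda>m. n \<le> e m"] strict_mono_less_eq[OF assms(2), of m x]
      unfolding m_def[symmetric] by linarith
    then have "e ` X \<inter> {..<n} = e ` (X \<inter> {..<m})" for X
      by auto
    then show ?thesis
      using le by (simp add: card_image inj)
  qed
  then have "e ` C \<in> I"
    using B by (auto intro: increasing_invariantD[OF assms(1), of "e ` B"])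
  then show "C \<in> {X. e ` X \<in> I}" by simp
qed

text \<open>Both \<open>{..<n}\<close> and its preimage under \<open>\<sigma>\<close> have
  \<open>n\<close> elements; removing their common part leaves the two crossing sets.\<close>

lemma card_crossing:
  fixes \<sigma> :: "nat \<Rightarrow> nat"
  assumes "bij \<sigma>"
  shows "finite {x. \<sigma> x < n}"
    and "card {x. x < n \<and> n \<le> \<sigma> x} = card {x. n \<le> x \<and> \<sigma> x < n}"
proof -
  have eq: "{x. \<sigma> x < n} = inv \<sigma> ` {..<n}"
    using assms bij_vimage_eq_inv_image[of \<sigma> "{..<n}"] by (auto simp: vimage_def)
  show fin: "finite {x. \<sigma> x < n}"
    unfolding eq by simp
  have "card {x. \<sigma> x < n} = n"
    unfolding eq using assms by (simp add: card_image bij_imp_bij_inv bij_is_inj inj_on_subset[of _ UNIV])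
  moreover have "card {x. \<sigma> x < n} = card {x. x < n \<and> \<sigma> x < n} + card {x. n \<le> x \<and> \<sigma> x < n}"
    by (subst card_Un_disjoint[symmetric])
      (auto intro: arg_cong[where f = card] finite_subset[OF _ fin])
  moreover have "card {..<n} = card {x. x < n \<and> \<sigma> x < n} + card {x. x < n \<and> n \<le> \<sigma> x}"
    by (subst card_Un_disjoint[symmetric]) (auto intro: arg_cong[where f = card] simp del: card_lessThan)
  ultimately show "card {x. x < n \<and> n \<le> \<sigma> x} = card {x. n \<le> x \<and> \<sigma> x < n}"
    by simp
qed

text \<open>\<open>T\<close> is the union of a growing chain of finite sets \<open>S n\<close>,
  where \<open>S n\<close> already meets the demand \<open>h n\<close> at level \<open>n\<close>. A
  point is added only when the demand outgrows the current set.\<close>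

lemma compensating_set:
  fixes \<sigma> :: "nat \<Rightarrow> nat"
  assumes "bij \<sigma>"
  obtains T where "\<And>t. t \<in> T \<Longrightarrow> \<sigma> t < t"
    and "\<And>n. card (T \<inter> {..<n}) \<le> card (C \<inter> {..<n})"
    and "\<And>n. card {c \<in> C. c < n \<and> n \<le> \<sigma> c} \<le> card (\<sigma> ` T \<inter> {..<n})"
proof -
  define h where "h n = card {c \<in> C. c < n \<and> n \<le> \<sigma> c}" for n
  define P where "P n X \<longleftrightarrow> finite X \<and> h n \<le> card X \<and> card X \<le> card (C \<inter> {..<n}) \<and>
    (\<forall>t\<in>X. \<sigma> t < t \<and> \<sigma> t < n)" for n X
  \<comment> \<open>Points added at stage \<open>n\<close> exceed \<open>n\<close>, so the final set
    has no points below \<open>n\<close> outside \<open>S n\<close>, and the upper bound in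
    \<open>P\<close> carries over to it.\<close>
  define Q where "Q n X Y \<longleftrightarrow> X \<subseteq> Y \<and> (\<forall>t\<in>Y - X. n < t)" for n and X Y :: "nat set"
  have step: "\<exists>Y. P (Suc n) Y \<and> Q n X Y" if X: "P n X" for n X
  proof (cases "h (Suc n) \<le> card X")
    case True
    have "card (C \<inter> {..<n}) \<le> card (C \<inter> {..<Suc n})"
      by (intro card_mono) auto
    then have "P (Suc n) X" "Q n X X"
      using X True unfolding P_def Q_def by (auto simp: less_Suc_eq)
    then show ?thesis by blast
  next
    case False
    let ?G = "{t. Suc n \<le> t \<and> \<sigma> t < Suc n}"
    have "h (Suc n) \<le> card {x. x < Suc n \<and> Suc n \<le> \<sigma> x}"
      unfolding h_def by (intro card_mono) auto
    then have "card X < card ?G"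
      using False card_crossing(2)[OF assms, of "Suc n"] by simp
    then have "\<not> ?G \<subseteq> X"
      using X card_mono[of X ?G] unfolding P_def by linarith
    then obtain t where t: "Suc n \<le> t" "\<sigma> t < Suc n" "t \<notin> X" by auto
    \<comment> \<open>Only \<open>n\<close> itself can cross level \<open>Suc n\<close> upwards
      without crossing level \<open>n\<close>. The demand thus grows by at most one, and a single
      new point suffices.\<close>
    have "h (Suc n) \<le> card (insert n {c \<in> C. c < n \<and> n \<le> \<sigma> c})"
      unfolding h_def by (intro card_mono) auto
    also have "\<dots> \<le> Suc (h n)"
      unfolding h_def by (simp add: card_insert_if)
    finally have 1: "h (Suc n) \<le> Suc (h n)" .
    have 2: "h (Suc n) \<le> card (C \<inter> {..<Suc n})"
      unfolding h_def by (intro card_mono) auto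
    have "P (Suc n) (insert t X)" "Q n X (insert t X)"
      using X t 1 2 False unfolding P_def Q_def by (auto simp: less_Suc_eq)
    then show ?thesis by blast
  qed
  have "P 0 {}"
    unfolding P_def h_def by simp
  then have "\<exists>S. \<forall>n. P n (S n) \<and> Q n (S n) (S (Suc n))"
    by (intro dependent_nat_choice step) (rule exI)
  then obtain S where "\<forall>n. P n (S n) \<and> Q n (S n) (S (Suc n))" ..
  then have S: "P n (S n)" "Q n (S n) (S (Suc n))" for n
    by (simp_all only:)
  have mono: "S m \<subseteq> S n" if "m \<le> n" for m n
    by (rule lift_Suc_mono_le[of S, OF _ that]) (use S(2) in \<open>auto simp: Q_def\<close>)
  have late: "t \<in> S n" if "t \<in> S k" "t < n" for t k n
    using that(1)
  proof (induction k)
    case 0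
    then show ?case using mono[of 0 n] by auto
  next
    case (Suc k)
    show ?case
    proof (cases "t \<in> S k")
      case False
      then have "k < t"
        using S(2)[of k] Suc.prems unfolding Q_def by auto
      then show ?thesis
        using mono[of "Suc k" n] Suc.prems that(2) by auto
    qed (rule Suc.IH)
  qed
  show thesis
  proof (rule that[of "\<Union>n. S n"])
    show "\<sigma> t < t" if "t \<in> (\<Union>n. S n)" for t
      using that S(1) unfolding P_def by blast
    fix n
    have "card ((\<Union>n. S n) \<inter> {..<n}) \<le> card (S n)"
      using S(1)[of n] late unfolding P_def by (intro card_mono) auto
    also have "\<dots> \<le> card (C \<inter> {..<n})"
      using S(1) unfolding P_def by blast
    finally show "card ((\<Union>n. S n) \<inter> {..<n}) \<le> card (C \<inter> {..<n})" .
    have "h n \<le> card (\<sigma> ` S n)"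
      using S(1)[of n] assms unfolding P_def
      by (metis bij_is_inj card_image inj_on_subset subset_UNIV)
    also have "\<dots> \<le> card (\<sigma> ` (\<Union>n. S n) \<inter> {..<n})"
      using S(1)[of n] unfolding P_def by (intro card_mono) auto
    finally show "card {c \<in> C. c < n \<and> n \<le> \<sigma> c} \<le> card (\<sigma> ` (\<Union>n. S n) \<inter> {..<n})"
      unfolding h_def .
  qed
qed

lemma increasing_invariant_bij_subset:
  fixes \<sigma> :: "nat \<Rightarrow> nat"
  assumes I: "increasing_invariant I" and un: "\<And>B C. B \<in> I \<Longrightarrow> C \<in> I \<Longrightarrow> B \<union> C \<in> I"
    and J: "increasing_invariant J" and "bij \<sigma>"
    and \<sigma>: "\<And>X. X \<in> J \<Longrightarrow> \<sigma> ` X \<in> I"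
  shows "J \<subseteq> I"
proof
  fix C assume C: "C \<in> J"
  have inj: "inj \<sigma>" using \<open>bij \<sigma>\<close> by (rule bij_is_inj)
  define D where "D = {c \<in> C. \<sigma> c \<le> c}"
  define U where "U = {c \<in> C. c < \<sigma> c}"
  have DJ: "D \<in> J" and UJ: "U \<in> J"
    using increasing_invariant_subset[OF J C] unfolding D_def U_def by auto
  have "inv \<sigma> ` \<sigma> ` D \<in> I"
    using \<sigma>[OF DJ] by (rule increasing_invariant_image[OF I]) (auto simp: D_def inj)
  then have DI: "D \<in> I"
    using inj by (simp add: image_inv_f_f)
  obtain T where down: "\<And>t. t \<in> T \<Longrightarrow> \<sigma> t < t"
    and le: "\<And>n. card (T \<inter> {..<n}) \<le> card (U \<inter> {..<n})"
    and ge: "\<And>n. card {c \<in> U. c < n \<and> n \<le> \<sigma> c} \<le> card (\<sigma> ` T \<inter> {..<n})"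
    using compensating_set[OF \<open>bij \<sigma>\<close>, of U] by blast
  have "T \<in> J"
    using J UJ le by (rule increasing_invariantD)
  then have "\<sigma> ` U \<union> \<sigma> ` T \<in> I"
    using UJ \<sigma> un by blast
  moreover have "card (U \<inter> {..<n}) \<le> card ((\<sigma> ` U \<union> \<sigma> ` T) \<inter> {..<n})" for n
  proof -
    \<comment> \<open>Points whose image stays below \<open>n\<close> are counted by
      \<open>\<sigma>\<close>
      U\<open>; those carried across level\<close>n\<open>are made up for by\<close>\<sigma>
      \<open>T\<close>.\<close>
    have "U \<inter> {..<n} = {c \<in> U. \<sigma> c < n} \<union> {c \<in> U. c < n \<and> n \<le> \<sigma> c}"
      by (auto simp: U_def)
    then have "card (U \<inter> {..<n}) \<le> card {c \<in> U. \<sigma> c < n} + card {c \<in> U. c < n \<and> n \<le> \<sigma> c}"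
      by (simp add: card_Un_le)
    also have "card {c \<in> U. \<sigma> c < n} = card (\<sigma> ` {c \<in> U. \<sigma> c < n})"
      using inj by (simp add: card_image inj_on_subset[of _ UNIV])
    also have "\<sigma> ` {c \<in> U. \<sigma> c < n} = \<sigma> ` U \<inter> {..<n}"
      by auto
    also have "card (\<sigma> ` U \<inter> {..<n}) + card {c \<in> U. c < n \<and> n \<le> \<sigma> c}
        \<le> card (\<sigma> ` U \<inter> {..<n}) + card (\<sigma> ` T \<inter> {..<n})"
      using ge by simp
    also have "\<dots> = card ((\<sigma> ` U \<inter> {..<n}) \<union> (\<sigma> ` T \<inter> {..<n}))"
    proof (intro card_Un_disjoint[symmetric])
      have "U \<inter> T = {}"
        using down less_asym unfolding U_def by blast
      then show "(\<sigma> ` U \<inter> {..<n}) \<inter> (\<sigma> ` T \<inter> {..<n}) = {}"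
        using image_Int[OF inj, of U T] by auto
    qed auto
    also have "(\<sigma> ` U \<inter> {..<n}) \<union> (\<sigma> ` T \<inter> {..<n}) = (\<sigma> ` U \<union> \<sigma> ` T) \<inter> {..<n}"
      by auto
    finally show ?thesis .
  qed
  ultimately have "U \<in> I"
    by (rule increasing_invariantD[OF I])
  moreover have "C = D \<union> U"
    unfolding D_def U_def by auto
  ultimately show "C \<in> I"
    using DI un by simp
qed

lemma restrict_ideal_iff:
  assumes "increasing_invariant I" "B \<subseteq> A"
  shows "B \<in> restrict_ideal I A \<longleftrightarrow> B \<in> I"
  unfolding restrict_ideal_def using increasing_invariant_subset[OF assms(1)] assms(2) by blast

theorem theorem6:
  fixes I :: "nat set set" and A :: "nat set"
  assumes "omega_ideal I"
    and "increasing_invariant I"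
    and "A \<in> homogeneity_family I"
  shows "witnesses_iso (enumerate A) I A"
proof -
  let ?e = "enumerate A"
  obtain \<phi> where "A \<notin> I" and \<phi>: "witnesses_iso \<phi> I A"
    using assms(3) unfolding homogeneity_family_def by blast
  then have inf: "infinite A"
    using assms(1) unfolding omega_ideal_def by blast
  have bij_e: "bij_betw ?e UNIV A"
    using inf by (rule bij_enumerate)
  have bij_\<phi>: "bij_betw \<phi> UNIV A"
    and iff_\<phi>: "\<And>B. B \<subseteq> A \<Longrightarrow> B \<in> I \<longleftrightarrow> \<phi> -` B \<in> I"
    using \<phi> restrict_ideal_iff[OF assms(2)] unfolding witnesses_iso_def by auto
  define \<sigma> where "\<sigma> = inv \<phi> \<circ> ?e"
  have "bij \<sigma>"
    unfolding \<sigma>_def using bij_e bij_betw_inv_into[OF bij_\<phi>] by (rule bij_betw_trans)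
  moreover have "\<sigma> ` X \<in> I" if "X \<in> {X. ?e ` X \<in> I}" for X
  proof -
    have sub: "?e ` X \<subseteq> A"
      using bij_e by (auto simp: bij_betw_def)
    have "\<phi> -` (?e ` X) = inv \<phi> ` ?e ` X"
    proof (intro equalityI subsetI)
      fix y assume "y \<in> \<phi> -` (?e ` X)"
      then show "y \<in> inv \<phi> ` ?e ` X"
        using bij_betw_imp_inj_on[OF bij_\<phi>] by (metis image_eqI inv_f_f vimageD)
    next
      fix y assume "y \<in> inv \<phi> ` ?e ` X"
      then show "y \<in> \<phi> -` (?e ` X)"
        using sub bij_betw_imp_surj_on[OF bij_\<phi>] by (auto simp: f_inv_into_f subset_iff)
    qed
    then have "\<sigma> ` X = \<phi> -` (?e ` X)"
      by (simp add: \<sigma>_def image_comp)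
    then show ?thesis
      using that iff_\<phi>[OF sub] by simp
  qed
  ultimately have sub: "{X. ?e ` X \<in> I} \<subseteq> I"
    using assms(1,2) inf
    by (intro increasing_invariant_bij_subset[where \<sigma> = \<sigma>] increasing_invariant_strict_mono_preimage)
      (auto simp: omega_ideal_def strict_mono_enumerate)
  have "B \<in> restrict_ideal I A \<longleftrightarrow> ?e -` B \<in> I" if "B \<subseteq> A" for B
  proof -
    have im: "?e ` (?e -` B) = B"
      using bij_e that by (auto simp: bij_betw_def)
    \<comment> \<open>This direction uses only that the enumeration satisfies
      \<open>n \<le> ?e n\<close>; the converse is where the inclusion \<open>sub\<close>
      enters.\<close>
    have "B \<in> I" if "?e -` B \<in> I"
      using increasing_invariant_image[OF assms(2) that, of ?e] le_enumerate[OF inf] im by simp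
    moreover have "?e -` B \<in> I" if "B \<in> I"
      using sub im that by auto
    ultimately show ?thesis
      using restrict_ideal_iff[OF assms(2) \<open>B \<subseteq> A\<close>] by blast
  qed
  then show ?thesis
    using bij_e unfolding witnesses_iso_def by blast
qed

end
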